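(* Let $c>0$, $c\neq 1$, $\gamma\ge 0$ and $\gamma+\beta>0$ be real. Then for every integer $n\ge 0$, as polynomials in $x$, $$\mathscr{M}_n(x;\beta,c,\gamma)=c^{-n}\frac{(\gamma+1)_n(\gamma+\beta)_n}{n!}\sum_{k=0}^{n}(1-c)^k\frac{(-n)_k(\gamma+\beta+x)_k}{(\gamma+1)_k(\gamma+\beta)_k}\;{}_4F_3\left(\begin{array}{c}k-n,\ \gamma+\beta+x+k,\ \gamma+\beta-1,\ \gamma\\ \gamma+\beta+x,\ \gamma+\beta+k,\ \gamma+1+k\end{array}\Big|\,1\right).$$
   Context: The associated Meixner polynomials $\mathscr{M}_n(x;\beta,c,\gamma)$ are defined by $\mathscr{M}_{-1}=0$, $\mathscr{M}_0=1$ and, for $n\ge 0$, $$c\,\mathscr{M}_{n+1}(x;\beta,c,\gamma)=[(c-1)x+(c+1)(n+\gamma)+\beta c]\,\mathscr{M}_n(x;\beta,c,\gamma)-(n+\gamma)(n+\gamma+\beta-1)\,\mathscr{M}_{n-1}(x;\beta,c,\gamma).$$ Pochhammer symbol: $(a)_0=1$, $(a)_k=a(a+1)\cdots(a+k-1)$ for $k\ge1$. The series ${}_4F_3\left(\begin{array}{c}k-n,a_2,a_3,a_4\\ b_1,b_2,b_3\end{array}\Big|1\right)=\sum_{j=0}^{n-k}\frac{(k-n)_j(a_2)_j(a_3)_j(a_4)_j}{(b_1)_j(b_2)_j(b_3)_j\,j!}$ is a terminating hypergeometric sum. Convention: the factor $(\gamma+\beta+x)_k(\gamma+\beta+x+k)_j/(\gamma+\beta+x)_j$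 occurring in each term is a polynomial in $x$ (equal to $(\gamma+\beta+x+j)_k$), so at the finitely many $x$ where $(\gamma+\beta+x)_j$ vanishes the right-hand side is understood by continuity in $x$. *)

theory Defs
  imports Complex_Main "HOL-Computational_Algebra.Polynomial"
begin

text \<open>
  The associated Meixner polynomials as elements of \<^typ>\<open>real poly\<close>: the linear polynomial
  \<open>[:(c+1)(n+\<gamma>) + \<beta>c, c-1:]\<close> is the coefficient \<open>(c-1)x + (c+1)(n+\<gamma>) + \<beta>c\<close> of the recurrence, and the
  case for \<open>0\<close> encodes the initial value \<open>0\<close> at index \<open>-1\<close>.  The recurrence is solved for its leading
  term, so it has the intended meaning for \<open>c \<noteq> 0\<close>; see \<open>assoc_meixner_recurrence\<close>.
\<close>

fun assoc_meixner :: "nat \<Rightarrow> real \<Rightarrow> real \<Rightarrow> real \<Rightarrow> real poly" where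
  "assoc_meixner 0 \<beta> c \<gamma> = 1"
| "assoc_meixner (Suc n) \<beta> c \<gamma> =
     smult (1 / c)
       ([:(c + 1) * (real n + \<gamma>) + \<beta> * c, c - 1:] * assoc_meixner n \<beta> c \<gamma>
        - smult ((real n + \<gamma>) * (real n + \<gamma> + \<beta> - 1))
            (case n of 0 \<Rightarrow> 0 | Suc m \<Rightarrow> assoc_meixner m \<beta> c \<gamma>))"

lemma assoc_meixner_recurrence:
  assumes "c \<noteq> 0"
  shows "c * poly (assoc_meixner (Suc n) \<beta> c \<gamma>) x =
     ((c - 1) * x + (c + 1) * (real n + \<gamma>) + \<beta> * c) * poly (assoc_meixner n \<beta> c \<gamma>) x
     - (real n + \<gamma>) * (real n + \<gamma> + \<beta> - 1) *
         (if n = 0 then 0 else poly (assoc_meixner (n - 1) \<beta> c \<gamma>) x)"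
proof -
  have "(case n of 0 \<Rightarrow> 0 | Suc m \<Rightarrow> assoc_meixner m \<beta> c \<gamma>)
        = (if n = 0 then 0 else assoc_meixner (n - 1) \<beta> c \<gamma>)"
    by (cases n) (simp_all del: assoc_meixner.simps)
  then show ?thesis
    using assms unfolding assoc_meixner.simps(2) by (simp add: algebra_simps del: assoc_meixner.simps)
qed

text \<open>
  The hypergeometric series \<open>4F3(-m, a2, a3, a4; b1, b2, b3 | 1)\<close>, which terminates because of the
  first numerator parameter.
\<close>

definition hyp4F3_terminating ::
    "nat \<Rightarrow> real \<Rightarrow> real \<Rightarrow> real \<Rightarrow> real \<Rightarrow> real \<Rightarrow> real \<Rightarrow> real" where
  "hyp4F3_terminating m a2 a3 a4 b1 b2 b3 =
     (\<Sum>j = 0..m. (pochhammer (- real m) j * pochhammer a2 j * pochhammer a3 j * pochhammer a4 j) /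
                 (pochhammer b1 j * pochhammer b2 j * pochhammer b3 j * fact j))"

text \<open>
  The right-hand side as a rational expression in \<open>x\<close>.  It has removable singularities at the zeros
  of \<open>pochhammer (\<gamma> + \<beta> + x) n\<close>; its HOL value there (with division by zero being zero) is not
  meaningful.
\<close>

definition assoc_meixner_rhs :: "nat \<Rightarrow> real \<Rightarrow> real \<Rightarrow> real \<Rightarrow> real \<Rightarrow> real" where
  "assoc_meixner_rhs n \<beta> c \<gamma> x =
     (1 / c ^ n) * (pochhammer (\<gamma> + 1) n * pochhammer (\<gamma> + \<beta>) n / fact n) *
     (\<Sum>k = 0..n. (1 - c) ^ k *
        (pochhammer (- real n) k * pochhammer (\<gamma> + \<beta> + x) k /
         (pochhammer (\<gamma> + 1) k * pochhammer (\<gamma> + \<beta>) k)) *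
        hyp4F3_terminating (n - k)
          (\<gamma> + \<beta> + x + real k) (\<gamma> + \<beta> - 1) \<gamma>
          (\<gamma> + \<beta> + x) (\<gamma> + \<beta> + real k) (\<gamma> + 1 + real k))"

end

theory Submission imports Defs begin

text \<open>
  Put \<open>a = \<gamma>\<close>, \<open>b = \<gamma> + \<beta>\<close>, \<open>y = \<gamma> + \<beta> + x\<close>, \<open>t = 1 - c\<close>.  Collecting the terms with \<open>k + j = m\<close>, the
  double sum, multiplied by \<open>c\<^sup>n\<close>, becomes \<open>\<Sum>m\<le>n. L n m * S m\<close>, where \<open>L\<close> does not involve \<open>y\<close> or \<open>t\<close>
  and \<open>S (m + 1) = t (y + m) S m + (a)\<^sub>m\<^sub>+\<^sub>1 (b - 1)\<^sub>m\<^sub>+\<^sub>1 / (m + 1)!\<close>.  Since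
  \<open>(n - m) L n m = (n + a) (n + b - 1) L (n - 1) m\<close>, the variable \<open>y\<close> enters the three-term recurrence only
  through \<open>t (y + m) S m\<close>, which the recurrence for \<open>S\<close> eliminates.  The coefficients of \<open>S m\<close> then
  cancel, and the inhomogeneous terms add up to an alternating sum of binomial coefficients.
\<close>

text \<open>For \<open>m \<le> n\<close> this is \<open>(a + 1)\<^sub>n (b)\<^sub>n (-n)\<^sub>m /
  (n! (a + 1)\<^sub>m (b)\<^sub>m)\<close> with the quotients carried out. No parameter stands in a
  denominator, so the relations below hold for all real \<open>a\<close> and
  \<open>b\<close>.\<close>

definition meixner_coeff :: "real \<Rightarrow> real \<Rightarrow> nat \<Rightarrow> nat \<Rightarrow> real" where
  "meixner_coeff a b n m =
     (-1) ^ m * pochhammer (a + 1 + real m) (n - m) * pochhammer (b + real m) (n - m) / fact (n - m)"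

definition meixner_source :: "real \<Rightarrow> real \<Rightarrow> nat \<Rightarrow> real" where
  "meixner_source a b j = pochhammer a j * pochhammer (b - 1) j / fact j"

text \<open>The factor \<open>(y + j)\<^sub>m\<^sub>-\<^sub>j\<close> is the cancelled form of
  \<open>(y)\<^sub>m / (y)\<^sub>j\<close>, which makes the sum a polynomial in
  \<open>y\<close>.\<close>

definition meixner_inner :: "real \<Rightarrow> real \<Rightarrow> real \<Rightarrow> real \<Rightarrow> nat \<Rightarrow> real" where
  "meixner_inner a b t y m =
     (\<Sum>j\<le>m. t ^ (m - j) * pochhammer (y + real j) (m - j) * meixner_source a b j)"

lemma meixner_inner_0 [simp]: "meixner_inner a b t y 0 = 1"
  by (simp add: meixner_inner_def meixner_source_def)

lemma meixner_inner_Suc: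
  "meixner_inner a b t y (Suc m) =
     t * (y + real m) * meixner_inner a b t y m + meixner_source a b (Suc m)"
proof -
  have "(\<Sum>j\<le>m. t ^ (Suc m - j) * pochhammer (y + real j) (Suc m - j) * meixner_source a b j)
      = (\<Sum>j\<le>m. t * (y + real m) *
          (t ^ (m - j) * pochhammer (y + real j) (m - j) * meixner_source a b j))"
    by (rule sum.cong) (auto simp: Suc_diff_le pochhammer_Suc of_nat_diff)
  then show ?thesis
    by (simp add: meixner_inner_def sum_distrib_left)
qed

lemma meixner_coeff_diag [simp]: "meixner_coeff a b n n = (-1) ^ n"
  by (simp add: meixner_coeff_def)

lemma meixner_coeff_Suc_left:
  assumes "m \<le> n"
  shows "(real n + 1 - real m) * meixner_coeff a b (Suc n) m =
           (real n + 1 + a) * (real n + b) * meixner_coeff a b n m"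
proof -
  obtain r where n: "n = m + r" using assms le_iff_add by blast
  have "real r + 1 \<noteq> 0" by linarith
  then show ?thesis
    by (simp add: n meixner_coeff_def Suc_diff_le pochhammer_Suc divide_simps) (simp add: algebra_simps)
qed

lemma meixner_coeff_Suc_right:
  assumes "Suc m \<le> n"
  shows "(real n - real m) * meixner_coeff a b n m =
           - ((a + 1 + real m) * (b + real m) * meixner_coeff a b n (Suc m))"
proof -
  obtain r where n: "n = Suc (m + r)" using assms by (metis add_Suc le_iff_add)
  have "real r + 1 \<noteq> 0" by linarith
  then show ?thesis
    by (simp add: n meixner_coeff_def Suc_diff_le pochhammer_rec divide_simps) (simp add: algebra_simps)
qed

text \<open>After multiplication by \<open>n - m\<close> all terms are multiples of
  \<open>meixner_coeff a b n (Suc m)\<close>. What remains is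
  \<open>f n - f m = (n - m) * (n + m + 1 + a + b)\<close> for the quadratic
  \<open>f z = (z + 1 + a) * (z + b)\<close>.\<close>

lemma meixner_coeff_three_term:
  assumes "m < n"
  shows "meixner_coeff a b (Suc n) (Suc m) =
           (real n + real (Suc m) + a + b) * meixner_coeff a b n (Suc m) - meixner_coeff a b n m"
proof -
  let ?d = "real n - real m"
  have "?d * meixner_coeff a b (Suc n) (Suc m) =
          (real n + 1 + a) * (real n + b) * meixner_coeff a b n (Suc m)"
    using meixner_coeff_Suc_left[of "Suc m" n a b] assms by simp
  moreover have "?d * meixner_coeff a b n m =
          - ((a + 1 + real m) * (b + real m) * meixner_coeff a b n (Suc m))"
    using meixner_coeff_Suc_right[of m n a b] assms by simp
  ultimately have "?d * meixner_coeff a b (Suc n) (Suc m) =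
      ?d * ((real n + real (Suc m) + a + b) * meixner_coeff a b n (Suc m) - meixner_coeff a b n m)"
    by (simp add: algebra_simps)
  then show ?thesis using assms by simp
qed

text \<open>
  The alternating binomial sum of order \<open>n + 1\<close>, whose term of index \<open>0\<close> is moved to the left-hand side.
\<close>

lemma meixner_coeff_source_sum:
  "a * (b - 1) * meixner_coeff a b n 0 =
     (real n + 1) * (\<Sum>m\<le>n. meixner_coeff a b n m * meixner_source a b (Suc m))"
proof -
  define C where "C = pochhammer a (Suc n) * pochhammer (b - 1) (Suc n) / fact (Suc n)"
  \<comment> \<open>The Pochhammer factors of the two functions join to full symbols of length
    \<open>n + 1\<close>, so only a signed binomial coefficient still depends on
    \<open>m\<close>.\<close>
  have term_eq: "meixner_coeff a b n m * meixner_source a b (Suc m) =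
          - C * ((-1) ^ Suc m * real (Suc n choose Suc m))" if "m \<le> n" for m
  proof -
    have "pochhammer a (Suc n) = pochhammer a (Suc m) * pochhammer (a + 1 + real m) (n - m)"
      using pochhammer_product[of "Suc m" "Suc n" a] that by (simp add: algebra_simps)
    moreover have "pochhammer (b - 1) (Suc n) = pochhammer (b - 1) (Suc m) * pochhammer (b + real m) (n - m)"
      using pochhammer_product[of "Suc m" "Suc n" "b - 1"] that by (simp add: algebra_simps)
    moreover have "real (Suc n choose Suc m) = fact (Suc n) / (fact (Suc m) * fact (n - m))"
      using binomial_fact[of "Suc m" "Suc n", where ?'a = real] that by simp
    ultimately show ?thesis
      by (simp add: C_def meixner_coeff_def meixner_source_def mult_ac del: fact_Suc binomial_Suc_Suc)
  qed
  have "(\<Sum>m\<le>Suc n. (-1) ^ m * real (Suc n choose m)) = 0"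
    by (rule choose_alternating_sum) simp
  then have "(\<Sum>m\<le>n. (-1) ^ Suc m * real (Suc n choose Suc m)) = -1"
    by (subst (asm) sum.atMost_Suc_shift) simp
  moreover have "(\<Sum>m\<le>n. meixner_coeff a b n m * meixner_source a b (Suc m))
      = - C * (\<Sum>m\<le>n. (-1) ^ Suc m * real (Suc n choose Suc m))"
    unfolding sum_distrib_left by (rule sum.cong) (use term_eq in auto)
  ultimately have "(\<Sum>m\<le>n. meixner_coeff a b n m * meixner_source a b (Suc m)) = C"
    by simp
  moreover have "(real n + 1) * C = a * (b - 1) * meixner_coeff a b n 0"
    by (simp add: C_def meixner_coeff_def pochhammer_rec add.commute divide_simps)
  ultimately show ?thesis by simp
qed

section \<open>Three-term recurrence in \<open>n\<close> for the regrouped sum\<close>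

definition meixner_sum :: "real \<Rightarrow> real \<Rightarrow> real \<Rightarrow> real \<Rightarrow> nat \<Rightarrow> real" where
  "meixner_sum a b t y n = (\<Sum>m\<le>n. meixner_coeff a b n m * meixner_inner a b t y m)"

lemma meixner_sum_0 [simp]: "meixner_sum a b t y 0 = 1"
  by (simp add: meixner_sum_def)

text \<open>The weight \<open>n - m\<close> removes the top term and lowers the index of each
  remaining coefficient. This produces the second-order term of the recurrence, with value 0 at
  index -1.\<close>

lemma weighted_meixner_sum:
  "(\<Sum>m\<le>n. (real n - real m) * (meixner_coeff a b n m * meixner_inner a b t y m)) =
     (real n + a) * (real n + b - 1) * (if n = 0 then 0 else meixner_sum a b t y (n - 1))"
proof (cases n)
  case (Suc p)
  have "(\<Sum>m\<le>p. (real n - real m) * (meixner_coeff a b n m * meixner_inner a b t y m)) =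
      (\<Sum>m\<le>p. (real n + a) * (real n + b - 1) * (meixner_coeff a b p m * meixner_inner a b t y m))"
  proof (rule sum.cong)
    fix m assume "m \<in> {..p}"
    then have "(real n - real m) * meixner_coeff a b n m =
        (real n + a) * (real n + b - 1) * meixner_coeff a b p m"
      using meixner_coeff_Suc_left[of m p a b] by (simp add: Suc algebra_simps)
    then show "(real n - real m) * (meixner_coeff a b n m * meixner_inner a b t y m) =
        (real n + a) * (real n + b - 1) * (meixner_coeff a b p m * meixner_inner a b t y m)"
      by (metis mult.assoc)
  qed simp
  then show ?thesis by (simp add: Suc meixner_sum_def sum_distrib_left)
qed simp

lemma meixner_sum_Suc:
  "meixner_sum a b t y (Suc n) =
     ((2 - t) * real n + a + b - t * y) * meixner_sum a b t y n
     - (1 - t) * (real n + a) * (real n + b - 1) *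
         (if n = 0 then 0 else meixner_sum a b t y (n - 1))"
proof -
  let ?L = "meixner_coeff a b" and ?S = "meixner_inner a b t y" and ?D = "meixner_source a b"
  \<comment> \<open>At index 0 the three-term relation has no left neighbour; the sum over the
    source terms takes its place.\<close>
  have L0: "?L (Suc n) 0 = (real n + a + b) * ?L n 0 + (\<Sum>m\<le>n. ?L n m * ?D (Suc m))"
  proof -
    have "(real n + 1) * ?L (Suc n) 0 =
        (real n + 1) * ((real n + a + b) * ?L n 0 + (\<Sum>m\<le>n. ?L n m * ?D (Suc m)))"
      using meixner_coeff_Suc_left[of 0 n a b] meixner_coeff_source_sum[of a b n]
      by (simp add: algebra_simps)
    moreover have "real n + 1 \<noteq> 0" by linarith
    ultimately show ?thesis by (metis mult_left_cancel)
  qed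
  \<comment> \<open>The two ranges differ because at \<open>m = n\<close> the three-term relation
    degenerates to \<open>?L (Suc n) (Suc n) = - ?L n n\<close>.\<close>
  have "(\<Sum>m\<le>n. ?L (Suc n) (Suc m) * ?S (Suc m)) =
      (\<Sum>m<n. (real n + real (Suc m) + a + b) * ?L n (Suc m) * ?S (Suc m))
      - (\<Sum>m\<le>n. ?L n m * ?S (Suc m))"
    by (simp add: lessThan_Suc_atMost[symmetric] meixner_coeff_three_term left_diff_distrib sum_subtractf)
  moreover have "(\<Sum>m\<le>n. (real n + real m + a + b) * ?L n m * ?S m) =
      (real n + a + b) * ?L n 0 +
      (\<Sum>m<n. (real n + real (Suc m) + a + b) * ?L n (Suc m) * ?S (Suc m))"
    by (subst sum.atMost_shift) simp
  moreover have "meixner_sum a b t y (Suc n) = ?L (Suc n) 0 + (\<Sum>m\<le>n. ?L (Suc n) (Suc m) * ?S (Suc m))"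
    unfolding meixner_sum_def by (subst sum.atMost_Suc_shift) simp
  moreover have "(\<Sum>m\<le>n. ?L n m * ?S (Suc m)) =
      (\<Sum>m\<le>n. t * (y + real m) * (?L n m * ?S m)) + (\<Sum>m\<le>n. ?L n m * ?D (Suc m))"
    by (simp add: meixner_inner_Suc sum.distrib[symmetric] algebra_simps)
  \<comment> \<open>The source sum in \<open>L0\<close> cancels the one created by expanding
    \<open>?S (Suc m)\<close>.\<close>
  ultimately have "meixner_sum a b t y (Suc n) =
      (\<Sum>m\<le>n. (real n + real m + a + b) * ?L n m * ?S m) - (\<Sum>m\<le>n. t * (y + real m) * (?L n m * ?S m))"
    using L0 by simp
  \<comment> \<open>Writing \<open>m = n - (n - m)\<close> isolates the weight \<open>n - m\<close>,
    leaving a factor independent of \<open>m\<close>.\<close>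
  also have "\<dots> = (\<Sum>m\<le>n. ((2 - t) * real n + a + b - t * y) * (?L n m * ?S m)
      - (1 - t) * ((real n - real m) * (?L n m * ?S m)))"
    unfolding sum_subtractf[symmetric] by (rule sum.cong) (auto simp: algebra_simps)
  also have "\<dots> = ((2 - t) * real n + a + b - t * y) * meixner_sum a b t y n
      - (1 - t) * (\<Sum>m\<le>n. (real n - real m) * (?L n m * ?S m))"
    by (simp add: sum_subtractf sum_distrib_left meixner_sum_def)
  finally show ?thesis
    by (simp add: weighted_meixner_sum mult.assoc)
qed

text \<open>With \<open>t = 1 - c\<close> and \<open>y = \<gamma> + \<beta> + x\<close>, the
  recurrence \<open>meixner_sum_Suc\<close> is the defining one, rescaled by \<open>c ^ n\<close> to
  absorb the division by \<open>c\<close> at each step.\<close>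

lemma poly_assoc_meixner:
  assumes "c \<noteq> 0"
  shows "c ^ n * poly (assoc_meixner n \<beta> c \<gamma>) x =
           meixner_sum \<gamma> (\<gamma> + \<beta>) (1 - c) (\<gamma> + \<beta> + x) n"
proof (induction n rule: less_induct)
  case (less n)
  show ?case
  proof (cases n)
    case (Suc p)
    let ?M = "\<lambda>n. poly (assoc_meixner n \<beta> c \<gamma>) x"
    let ?Q = "meixner_sum \<gamma> (\<gamma> + \<beta>) (1 - c) (\<gamma> + \<beta> + x)"
    have prev: "c * c ^ p * (if p = 0 then 0 else ?M (p - 1)) =
        c\<^sup>2 * (if p = 0 then 0 else ?Q (p - 1))"
      using less.IH[of "p - 1"] Suc by (cases p) (auto simp: power2_eq_square)
    have IH: "?Q p = c ^ p * ?M p"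
      using less.IH[of p] Suc by simp
    let ?h = "(real p + \<gamma>) * (real p + \<gamma> + \<beta> - 1)"
    have "c * (c ^ Suc p * ?M (Suc p)) = c * c ^ p * (c * ?M (Suc p))"
      by simp
    also have "\<dots> = c * ((c - 1) * x + (c + 1) * (real p + \<gamma>) + \<beta> * c) * (c ^ p * ?M p)
        - ?h * (c * c ^ p * (if p = 0 then 0 else ?M (p - 1)))"
      unfolding assoc_meixner_recurrence[OF assms] by (simp only: algebra_simps)
    also have "\<dots> = c * (((c - 1) * x + (c + 1) * (real p + \<gamma>) + \<beta> * c) * ?Q p
        - c * ?h * (if p = 0 then 0 else ?Q (p - 1)))"
      unfolding prev IH by (simp add: algebra_simps power2_eq_square)
    also have "\<dots> = c * ?Q (Suc p)"
      unfolding meixner_sum_Suc by (simp add: algebra_simps)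
    finally show ?thesis
      using assms Suc by simp
  qed simp
qed

section \<open>Regrouping of the hypergeometric double sum\<close>

lemma pochhammer_neg_nat_over_fact:
  assumes "m \<le> n"
  shows "pochhammer (- real n) m / fact n = (-1) ^ m / fact (n - m)"
proof -
  have "real (n choose m) = (-1) ^ m * pochhammer (- real n) m / fact m"
    by (simp add: binomial_gbinomial gbinomial_pochhammer)
  moreover have "real (n choose m) = fact n / (fact m * fact (n - m))"
    using binomial_fact[OF assms, where ?'a = real] by simp
  ultimately have "(-1) ^ m * pochhammer (- real n) m = fact n / fact (n - m)"
    by (simp add: field_simps)
  then have "(-1) ^ m * ((-1) ^ m * pochhammer (- real n) m) = (-1) ^ m * (fact n / fact (n - m))"
    by simp
  then show ?thesis by (simp add: mult.assoc[symmetric] power_mult_distrib[symmetric] field_simps)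
qed

text \<open>Positivity of \<open>\<gamma> + 1\<close> and \<open>\<gamma> + \<beta>\<close> keeps
  the parameter denominators nonzero, while \<open>nz\<close> allows \<open>(y)\<^sub>j\<close> to
  be cancelled for every \<open>j \<le> n\<close>.\<close>

lemma assoc_meixner_rhs_eq_meixner_sum:
  assumes "\<gamma> \<ge> 0" "\<gamma> + \<beta> > 0" and nz: "pochhammer (\<gamma> + \<beta> + x) n \<noteq> 0"
  shows "assoc_meixner_rhs n \<beta> c \<gamma> x =
           meixner_sum \<gamma> (\<gamma> + \<beta>) (1 - c) (\<gamma> + \<beta> + x) n / c ^ n"
proof -
  define b y where "b = \<gamma> + \<beta>" and "y = \<gamma> + \<beta> + x"
  let ?A = "pochhammer (\<gamma> + 1) n * pochhammer b n / fact n"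
  let ?f = "\<lambda>k j. (1 - c) ^ k * (pochhammer (- real n) k * pochhammer y k /
         (pochhammer (\<gamma> + 1) k * pochhammer b k)) *
         ((pochhammer (- real (n - k)) j * pochhammer (y + real k) j * pochhammer (b - 1) j * pochhammer \<gamma> j) /
         (pochhammer y j * pochhammer (b + real k) j * pochhammer (\<gamma> + 1 + real k) j * fact j))"
  let ?g = "\<lambda>k j. meixner_coeff \<gamma> b n (k + j) *
         ((1 - c) ^ k * pochhammer (y + real j) k * meixner_source \<gamma> b j)"
  have term_eq: "?A * ?f k j = ?g k j" if kj: "k + j \<le> n" for k j
  proof -
    have split: "pochhammer z k * pochhammer (z + real k) j = pochhammer z (k + j)" for z :: real
      using pochhammer_product'[of z k j] by simp
    have yj: "pochhammer y j \<noteq> 0"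
      using nz kj unfolding y_def by (metis add.commute le_add2 le_trans pochhammer_eq_0_mono)
    have yk: "pochhammer y (k + j) = pochhammer y j * pochhammer (y + real j) k"
      using pochhammer_product'[of y j k] by (simp add: add.commute)
    have pos: "pochhammer (\<gamma> + 1) (k + j) > 0" "pochhammer b (k + j) > 0"
      using assms by (auto simp: b_def intro!: pochhammer_pos)
    have nk: "pochhammer (- real n) k * pochhammer (- real (n - k)) j = pochhammer (- real n) (k + j)"
      using split[of "- real n"] kj by (simp add: of_nat_diff)
    \<comment> \<open>Each symbol of length \<open>k\<close> is paired with its continuation of
      length \<open>j\<close>, to be merged into one of length \<open>k + j\<close>.\<close>
    have "?f k j = (1 - c) ^ k * (pochhammer (- real n) k * pochhammer (- real (n - k)) j)
        * (pochhammer y k * pochhammer (y + real k) j) * meixner_source \<gamma> b j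
        / (pochhammer y j * (pochhammer (\<gamma> + 1) k * pochhammer (\<gamma> + 1 + real k) j)
           * (pochhammer b k * pochhammer (b + real k) j))"
      by (simp add: meixner_source_def mult_ac)
    also have "\<dots> = (1 - c) ^ k * pochhammer (- real n) (k + j) * pochhammer (y + real j) k
        * meixner_source \<gamma> b j / (pochhammer (\<gamma> + 1) (k + j) * pochhammer b (k + j))"
      unfolding nk split yk using yj by simp
    finally have f: "?f k j = \<dots>" .
    have "?A * ?f k j = (1 - c) ^ k * pochhammer (y + real j) k * meixner_source \<gamma> b j
        * (pochhammer (- real n) (k + j) / fact n)
        * (pochhammer (\<gamma> + 1) n / pochhammer (\<gamma> + 1) (k + j)) * (pochhammer b n / pochhammer b (k + j))"
      unfolding f by (simp add: mult_ac)
    also have "pochhammer (\<gamma> + 1) n / pochhammer (\<gamma> + 1) (k + j) =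
        pochhammer (\<gamma> + 1 + real (k + j)) (n - (k + j))"
      using pochhammer_product[OF kj, of "\<gamma> + 1"] pos by simp
    also have "pochhammer b n / pochhammer b (k + j) = pochhammer (b + real (k + j)) (n - (k + j))"
      using pochhammer_product[OF kj, of b] pos by simp
    finally show ?thesis
      unfolding pochhammer_neg_nat_over_fact[OF kj] by (simp add: meixner_coeff_def)
  qed
  have "assoc_meixner_rhs n \<beta> c \<gamma> x = (1 / c ^ n) * (?A * (\<Sum>k\<le>n. \<Sum>j\<le>n - k. ?f k j))"
    unfolding assoc_meixner_rhs_def hyp4F3_terminating_def b_def y_def
    by (simp only: sum_distrib_left atLeast0AtMost mult.assoc)
  also have "?A * (\<Sum>k\<le>n. \<Sum>j\<le>n - k. ?f k j) = (\<Sum>k\<le>n. \<Sum>j\<le>n - k. ?g k j)"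
    unfolding sum_distrib_left by (intro sum.cong refl) (simp only: atMost_iff term_eq le_diff_conv2)
  also have "\<dots> = (\<Sum>(k, j)\<in>(SIGMA k:{..n}. {..n - k}). ?g k j)"
    by (rule sum.Sigma) auto
  \<comment> \<open>The swap makes \<open>j\<close> the inner variable on each diagonal
    \<open>k + j = m\<close>, as in \<open>meixner_inner\<close>.\<close>
  also have "\<dots> = (\<Sum>(j, k)\<in>{(j, k). j + k \<le> n}. ?g k j)"
    by (rule sum.reindex_bij_witness[of _ prod.swap prod.swap]) auto
  also have "\<dots> = (\<Sum>m\<le>n. \<Sum>j\<le>m. ?g (m - j) j)"
    by (rule sum.triangle_reindex_eq)
  also have "\<dots> = meixner_sum \<gamma> b (1 - c) y n"
    by (simp add: meixner_sum_def meixner_inner_def sum_distrib_left)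
  finally show ?thesis by (simp add: b_def y_def)
qed

text \<open>The zeros \<open>u = - k - b\<close> with \<open>k < n\<close> are finite in number, so
  a punctured neighbourhood of any point avoids them.\<close>

lemma eventually_pochhammer_add_nonzero:
  "\<forall>\<^sub>F u in at (x::real). pochhammer (b + u) n \<noteq> 0"
proof -
  have "\<forall>\<^sub>F u in at x. \<forall>k\<in>{..<n}. u \<noteq> - real k - b"
    by (intro eventually_ball_finite ballI finite_lessThan eventually_neq_at_within)
  then show ?thesis
    by eventually_elim (auto simp: pochhammer_eq_0_iff algebra_simps)
qed

theorem proposition2p1:
  fixes c \<gamma> \<beta> :: real and n :: nat
  assumes "c > 0" and "c \<noteq> 1" and "\<gamma> \<ge> 0" and "\<gamma> + \<beta> > 0"
  shows "(\<forall>x::real. pochhammer (\<gamma> + \<beta> + x) n \<noteq> 0 \<longrightarrow>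
            poly (assoc_meixner n \<beta> c \<gamma>) x = assoc_meixner_rhs n \<beta> c \<gamma> x) \<and>
         (\<forall>x::real. (assoc_meixner_rhs n \<beta> c \<gamma> \<longlongrightarrow> poly (assoc_meixner n \<beta> c \<gamma>) x) (at x))"
proof -
  have eq: "poly (assoc_meixner n \<beta> c \<gamma>) x = assoc_meixner_rhs n \<beta> c \<gamma> x"
    if "pochhammer (\<gamma> + \<beta> + x) n \<noteq> 0" for x
    using assms(1) by (simp add: assoc_meixner_rhs_eq_meixner_sum[OF assms(3,4) that]
        flip: poly_assoc_meixner)
  \<comment> \<open>This is the convention of continuity at the removable singularities: the limit
    ignores the value at \<open>x\<close> itself, and nearby both sides agree.\<close>
  have "(assoc_meixner_rhs n \<beta> c \<gamma> \<longlongrightarrow> poly (assoc_meixner n \<beta> c \<gamma>) x) (at x)" for x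
  proof (rule Lim_transform_eventually)
    show "(poly (assoc_meixner n \<beta> c \<gamma>) \<longlongrightarrow> poly (assoc_meixner n \<beta> c \<gamma>) x) (at x)"
      using poly_isCont isCont_def by blast
    show "\<forall>\<^sub>F u in at x. poly (assoc_meixner n \<beta> c \<gamma>) u = assoc_meixner_rhs n \<beta> c \<gamma> u"
      using eventually_pochhammer_add_nonzero[of "\<gamma> + \<beta>" n x] by eventually_elim (rule eq)
  qed
  with eq show ?thesis by blast
qed

end
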